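(* Let the sequence $(a(n))_{n \geq 1}$ of integers be defined by $a(1) = 7$ and $a(n) = a(n-1) + \gcd(n, a(n-1))$ for $n \geq 2$. Then for each integer $n \geq 2$, the difference $a(n) - a(n-1)$ is $1$ or a prime number. *)

theory Defs
  imports "HOL-Number_Theory.Number_Theory"
begin

end

theory Submission
  imports Defs
begin

text \<open>
  The sequence returns again and again to the line \<open>a(m) = 3m\<close>, starting with \<open>a(3) = 9\<close>.
  Suppose that \<open>a(m) = 3m\<close> and that the \<open>i\<close> increments after it were all 1, so that
  \<open>a(m + i) = 3m + i\<close>. The next increment is then
  \<open>gcd (m + i + 1) (3m + i) = gcd (2i + 3) (2m - 1)\<close> (\<open>gcd_shifted_triple\<close>), so successive
  increments compare the fixed odd number \<open>2m - 1\<close> with \<open>3, 5, 7, \<dots>\<close> in turn. The first of these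
  numbers that is not coprime to \<open>2m - 1\<close> is its least prime factor \<open>p\<close>, so the first increment
  other than 1 is the prime \<open>p = 2i + 3\<close> (\<open>gcd_first_common_factor\<close>). Adding it gives
  \<open>3m + i + (2i + 3) = 3 (m + i + 1)\<close>: the sequence is back on the line, and the argument restarts
  there. This scheme is the invariant proved by induction in the main theorem; only the
  increments up to \<open>a(3)\<close> precede it, and both are 1.
\<close>

text \<open>
  Two linear combinations eliminate \<open>m\<close> and \<open>k\<close> in turn. They have determinant 2, which is harmless
  since the common divisors on the right-hand side are odd.
\<close>
lemma gcd_shifted_triple:
  fixes m k :: int
  shows "gcd (m + k) (3 * m + k - 1) = gcd (2 * k + 1) (2 * m - 1)"
proof (rule zdvd_antisym_nonneg)
  let ?d = "gcd (m + k) (3 * m + k - 1)" and ?e = "gcd (2 * k + 1) (2 * m - 1)"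
  have "?d dvd (3 * m + k - 1) - (m + k)" by (intro dvd_diff gcd_dvd1 gcd_dvd2)
  then have d1: "?d dvd 2 * m - 1" by (simp add: algebra_simps)
  have "?d dvd 2 * (m + k) - (2 * m - 1)" by (intro dvd_diff d1 dvd_mult gcd_dvd1)
  then have "?d dvd 2 * k + 1" by (simp add: algebra_simps)
  with d1 show "?d dvd ?e" by simp
  have "?e dvd (2 * k + 1) + (2 * m - 1)" by (intro dvd_add gcd_dvd1 gcd_dvd2)
  then have "?e dvd 2 * (m + k)" by (simp add: algebra_simps)
  moreover have "coprime ?e 2"
  proof -
    have "odd (2 * k + 1)" by simp
    then have "odd ?e" by (meson dvd_trans gcd_dvd1)
    then show ?thesis by (simp add: coprime_commute)
  qed
  ultimately have e1: "?e dvd m + k" by (simp only: coprime_dvd_mult_right_iff)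
  have "?e dvd (m + k) + (2 * m - 1)" by (intro dvd_add e1 gcd_dvd2)
  then have "?e dvd 3 * m + k - 1" by (simp add: algebra_simps)
  with e1 show "?e dvd ?d" by simp
qed auto

text \<open>
  A prime factor of the gcd is itself one of the odd numbers \<open>3, 5, \<dots>, 2i + 3\<close>, and it divides \<open>M\<close>;
  by the coprimality hypothesis it can only be the last of them.
\<close>
lemma gcd_first_common_factor:
  fixes i M :: int
  assumes "0 \<le> i"
    and coprime: "\<And>j. 1 \<le> j \<Longrightarrow> j \<le> i \<Longrightarrow> coprime (2 * j + 1) M"
    and nontrivial: "gcd (2 * i + 3) M \<noteq> 1"
  shows "gcd (2 * i + 3) M = 2 * i + 3" and "prime (2 * i + 3)"
proof -
  let ?d = "gcd (2 * i + 3) M"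
  have "\<not> is_unit ?d" using nontrivial by simp
  then obtain q where q: "prime q" "q dvd ?d"
    using prime_divisor_exists[of ?d] \<open>0 \<le> i\<close> by auto
  then have q_dvd: "q dvd 2 * i + 3" "q dvd M" by auto
  have "q \<le> 2 * i + 3" using q_dvd(1) \<open>0 \<le> i\<close> by (intro zdvd_imp_le) auto
  have "odd (2 * i + 3)" by simp
  then have "odd q" using q_dvd(1) by (meson dvd_trans)
  then obtain j where j: "q = 2 * j + 1" by (elim oddE)
  have "1 \<le> j" using prime_ge_2_int[OF q(1)] j by linarith
  have "\<not> coprime q M"
    using q(1) q_dvd(2) by (meson coprime_common_divisor dvd_refl not_prime_unit)
  then have "\<not> j \<le> i" using coprime[OF \<open>1 \<le> j\<close>] j by auto
  with \<open>q \<le> 2 * i + 3\<close> j have "q = 2 * i + 3" by linarith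
  with q(1) q_dvd(2) show "prime (2 * i + 3)" "?d = 2 * i + 3"
    using \<open>0 \<le> i\<close> by (auto simp: gcd_proj1_iff)
qed

theorem mainTheorem1:
  fixes a :: "nat \<Rightarrow> int"
  assumes "a 1 = 7"
    and "\<And>n. n \<ge> 2 \<Longrightarrow> a n = a (n - 1) + gcd (int n) (a (n - 1))"
  shows "\<forall>n\<ge>2. a n - a (n - 1) = 1 \<or> prime (a n - a (n - 1))"
proof -
  have step: "a (Suc n) = a n + gcd (int (Suc n)) (a n)" if "1 \<le> n" for n
    using assms(2)[of "Suc n"] that by simp
  have a2: "a 2 = 8"
    using assms(2)[of 2] assms(1) by simp
  have a3: "a 3 = 9"
  proof -
    have "gcd 3 (8 :: int) = 1" by code_simp
    then show ?thesis using assms(2)[of 3] a2 by simp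
  qed
  \<comment> \<open>\<open>m\<close> is the last index with \<open>a(m) = 3m\<close>, and \<open>i\<close> counts the increments equal to 1 since then.\<close>
  define run where "run n m i \<longleftrightarrow> int n = m + i \<and> a n = 3 * m + i \<and> 0 \<le> i \<and>
    (\<forall>j. 1 \<le> j \<longrightarrow> j \<le> i \<longrightarrow> coprime (2 * j + 1) (2 * m - 1))" for n m i
  have advance: "(a (Suc n) - a n = 1 \<and> run (Suc n) m (i + 1)) \<or>
      (prime (a (Suc n) - a n) \<and> run (Suc n) (m + i + 1) 0)"
    if "1 \<le> n" and run: "run n m i" for n m i
  proof -
    from run have n: "int n = m + i" and an: "a n = 3 * m + i" and "0 \<le> i"
      and cop: "\<And>j. 1 \<le> j \<Longrightarrow> j \<le> i \<Longrightarrow> coprime (2 * j + 1) (2 * m - 1)"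
      by (auto simp: run_def)
    let ?d = "gcd (2 * i + 3) (2 * m - 1)"
    have "gcd (int (Suc n)) (a n) = ?d"
      using gcd_shifted_triple[of m "i + 1"] n an by (simp add: algebra_simps)
    with step[OF \<open>1 \<le> n\<close>] have diff: "a (Suc n) = a n + ?d" by simp
    show ?thesis
    proof (cases "?d = 1")
      case True
      have "coprime (2 * j + 1) (2 * m - 1)" if "1 \<le> j" "j \<le> i + 1" for j
      proof (cases "j = i + 1")
        case True
        then have "2 * j + 1 = 2 * i + 3" by simp
        with \<open>?d = 1\<close> show ?thesis by (simp only: coprime_iff_gcd_eq_1)
      next
        case False
        with that show ?thesis by (intro cop) auto
      qed
      with True diff n an \<open>0 \<le> i\<close> show ?thesis by (simp add: run_def)
    next
      case False
      note first = gcd_first_common_factor[OF \<open>0 \<le> i\<close> cop False]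
      from first diff n an show ?thesis by (simp add: run_def)
    qed
  qed
  have invariant: "\<exists>m i. run n m i" if "3 \<le> n" for n
    using that
  proof (induction n rule: dec_induct)
    case base
    have "run 3 3 0" using a3 by (simp add: run_def)
    then show ?case by blast
  next
    case (step n)
    then obtain m i where "run n m i" by blast
    moreover from \<open>3 \<le> n\<close> have "1 \<le> n" by simp
    ultimately show ?case using advance by blast
  qed
  show ?thesis
  proof (intro allI impI)
    fix n :: nat
    assume "2 \<le> n"
    then consider "n = 2" | "n = 3" | "3 \<le> n - 1" by linarith
    then show "a n - a (n - 1) = 1 \<or> prime (a n - a (n - 1))"
    proof cases
      case 1
      then show ?thesis using assms(1) a2 by simp
    next
      case 2
      then show ?thesis using a2 a3 by simp
    next
      case 3
      from invariant[OF 3] obtain m i where "run (n - 1) m i" by blast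
      with advance[of "n - 1" m i] 3 show ?thesis by auto
    qed
  qed
qed

end
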